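(* For all $\alpha\in E$, $d\in\mathbb N$ and sequents $\Gamma$: if $\vdash^\alpha_{d+1}\Gamma$ then $\vdash^{\omega(\alpha)}_d\Gamma$; and if $\vdash^\alpha_d\Gamma$ then $\vdash^{\omega(\alpha,d)}_0\Gamma$, where $\omega(\alpha,0)=\alpha$ and $\omega(\alpha,n+1)=\omega(\omega(\alpha,n))$.
   Context: $\mathcal L_{\mathsf{PA}}$ is the first-order language with constant $0$, unary function $S$, binary functions $+,\times$ and binary relations $\leq,=$; $\mathcal L^X_{\mathsf{PA}}$ adds a unary relation symbol $X$. Formulas are in negation normal form: built from literals by $\land,\lor,\forall,\exists$; $\neg\varphi$ is defined via de Morgan's laws (so $\neg\neg\varphi$ is $\varphi$). "True" refers to the standard model $\mathbb N$. Rank: literals have rank $0$, $\mathrm{rk}(\varphi_0\land\varphi_1)=\mathrm{rk}(\varphi_0\lor\varphi_1)=\max+1$, $\mathrm{rk}(\forall x\varphi)=\mathrm{rk}(\exists x\varphi)=\mathrm{rk}(\varphi)+1$. $(E,\prec)$ is a well order with: a unary map $\alpha\mapsto\alpha+1$ with $\alpha\prec\alpha+1$; elements $0,\omega\in E$ with $0\prec\omega$ such that $\alpha\prec\omega$ implies $\alpha+1\prec\omega$; a binary operation $+:E^2\to E$ (distinct from the unary map, which is always meant by "$\alpha+1$") with $\alpha+0=\alpha$ and $\beta\prec\gamma\Rightarrow\alpha+\beta\prec\alpha+\gamma$; a map $\omega:E\to E$ with $\alpha\prec\beta\Rightarrow\omega(\alpha)\prec\omega(\beta)$ and $\alpha,\beta\prec\omega(\gamma)\Rightarrow\alpha+\beta\prec\omega(\gamma)$;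 moreover $\alpha\prec\beta$ implies $\alpha+1\preceq\beta$, and $0\preceq\alpha$ for all $\alpha$. $x\lhd y$ is a fixed $\mathcal L_{\mathsf{PA}}$-formula with free variables $x,y$ only, defining a well order on $\mathbb N$. A sequent is a finite set of $\mathcal L^X_{\mathsf{PA}}$-sentences; $\Gamma,\varphi$ denotes $\Gamma\cup\{\varphi\}$. By recursion on $\alpha\in E$, $\vdash^\alpha_d\Gamma$ holds exactly if one of: (i) $\Gamma$ contains a true $\mathcal L_{\mathsf{PA}}$-literal, or $Xs$ and $\neg Xt$ with closed terms $s,t$ of equal value; (ii) $\Gamma$ contains $\varphi_0\land\varphi_1$ (resp. $\varphi_0\lor\varphi_1$) and for every (resp. some) $i\in\{0,1\}$: $\vdash^{\alpha(i)}_{d(i)}\Delta_i$ with $\alpha(i)\prec\alpha$, $d(i)\leq d$, $\Delta_i\subseteq\Gamma,\varphi_i$; (iii) $\Gamma$ contains $\forall x\varphi$ (resp. $\exists x\varphi$) and for every (resp. some) closed term $t$: $\vdash^{\alpha(t)}_{d(t)}\Delta_t$ with $\alpha(t)\prec\alpha$, $d(t)\leq d$, $\Delta_t\subseteq\Gamma,\varphi[x/t]$; (iv) $\Gamma$ contains $Xt$ and for every closed term $s$ with $s\lhd t$ (by value): $\vdash^{\alpha(s)}_{d(s)}\Delta_s$ with $\alpha(s)\prec\alpha$, $d(s)\leq d$, $\Delta_s\subseteq\Gamma,Xs$; (v) for some sentence $\varphi$ with $\mathrm{rk}(\varphi)<d$: $\vdash^{\alpha(0)}_{d(0)}\Delta_0$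 and $\vdash^{\alpha(1)}_{d(1)}\Delta_1$ with $\alpha(i)\prec\alpha$, $d(i)\leq d$, $\Delta_0\subseteq\Gamma,\varphi$, $\Delta_1\subseteq\Gamma,\neg\varphi$. *)

theory Defs
  imports Main
begin

datatype tm = Var nat | Zero | Succ tm | Add tm tm | Mult tm tm

datatype atom = Eq tm tm | Leq tm tm | X tm

datatype fm =
    Pos atom
  | Neg atom
  | Conj fm fm
  | Disj fm fm
  | All nat fm
  | Ex nat fm

primrec vars_tm :: "tm \<Rightarrow> nat set" where
  "vars_tm (Var x) = {x}"
| "vars_tm Zero = {}"
| "vars_tm (Succ t) = vars_tm t"
| "vars_tm (Add s t) = vars_tm s \<union> vars_tm t"
| "vars_tm (Mult s t) = vars_tm s \<union> vars_tm t"

primrec vars_atom :: "atom \<Rightarrow> nat set" where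
  "vars_atom (Eq s t) = vars_tm s \<union> vars_tm t"
| "vars_atom (Leq s t) = vars_tm s \<union> vars_tm t"
| "vars_atom (X t) = vars_tm t"

primrec free_vars :: "fm \<Rightarrow> nat set" where
  "free_vars (Pos a) = vars_atom a"
| "free_vars (Neg a) = vars_atom a"
| "free_vars (Conj \<phi> \<psi>) = free_vars \<phi> \<union> free_vars \<psi>"
| "free_vars (Disj \<phi> \<psi>) = free_vars \<phi> \<union> free_vars \<psi>"
| "free_vars (All x \<phi>) = free_vars \<phi> - {x}"
| "free_vars (Ex x \<phi>) = free_vars \<phi> - {x}"

definition closed_tm :: "tm \<Rightarrow> bool" where
  "closed_tm t \<longleftrightarrow> vars_tm t = {}"

definition sentence :: "fm \<Rightarrow> bool" where
  "sentence \<phi> \<longleftrightarrow> free_vars \<phi> = {}"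

definition sequent :: "fm set \<Rightarrow> bool" where
  "sequent \<Gamma> \<longleftrightarrow> finite \<Gamma> \<and> (\<forall>\<phi>\<in>\<Gamma>. sentence \<phi>)"

primrec PA_atom :: "atom \<Rightarrow> bool" where
  "PA_atom (Eq s t) \<longleftrightarrow> True"
| "PA_atom (Leq s t) \<longleftrightarrow> True"
| "PA_atom (X t) \<longleftrightarrow> False"

primrec PA_fm :: "fm \<Rightarrow> bool" where
  "PA_fm (Pos a) \<longleftrightarrow> PA_atom a"
| "PA_fm (Neg a) \<longleftrightarrow> PA_atom a"
| "PA_fm (Conj \<phi> \<psi>) \<longleftrightarrow> PA_fm \<phi> \<and> PA_fm \<psi>"
| "PA_fm (Disj \<phi> \<psi>) \<longleftrightarrow> PA_fm \<phi> \<and> PA_fm \<psi>"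
| "PA_fm (All x \<phi>) \<longleftrightarrow> PA_fm \<phi>"
| "PA_fm (Ex x \<phi>) \<longleftrightarrow> PA_fm \<phi>"

primrec neg :: "fm \<Rightarrow> fm" where
  "neg (Pos a) = Neg a"
| "neg (Neg a) = Pos a"
| "neg (Conj \<phi> \<psi>) = Disj (neg \<phi>) (neg \<psi>)"
| "neg (Disj \<phi> \<psi>) = Conj (neg \<phi>) (neg \<psi>)"
| "neg (All x \<phi>) = Ex x (neg \<phi>)"
| "neg (Ex x \<phi>) = All x (neg \<phi>)"

lemma neg_neg: "neg (neg \<phi>) = \<phi>"
  by (induction \<phi>) auto

primrec rk :: "fm \<Rightarrow> nat" where
  "rk (Pos a) = 0"
| "rk (Neg a) = 0"
| "rk (Conj \<phi> \<psi>) = max (rk \<phi>) (rk \<psi>) + 1"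
| "rk (Disj \<phi> \<psi>) = max (rk \<phi>) (rk \<psi>) + 1"
| "rk (All x \<phi>) = rk \<phi> + 1"
| "rk (Ex x \<phi>) = rk \<phi> + 1"

primrec subst_tm :: "nat \<Rightarrow> tm \<Rightarrow> tm \<Rightarrow> tm" where
  "subst_tm x t (Var y) = (if y = x then t else Var y)"
| "subst_tm x t Zero = Zero"
| "subst_tm x t (Succ s) = Succ (subst_tm x t s)"
| "subst_tm x t (Add r s) = Add (subst_tm x t r) (subst_tm x t s)"
| "subst_tm x t (Mult r s) = Mult (subst_tm x t r) (subst_tm x t s)"

primrec subst_atom :: "nat \<Rightarrow> tm \<Rightarrow> atom \<Rightarrow> atom" where
  "subst_atom x t (Eq r s) = Eq (subst_tm x t r) (subst_tm x t s)"
| "subst_atom x t (Leq r s) = Leq (subst_tm x t r) (subst_tm x t s)"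
| "subst_atom x t (X s) = X (subst_tm x t s)"

text \<open>Substitution for the free occurrences of \<open>x\<close>. Bound variables are not renamed, so this is
  capture-avoiding only for closed \<open>t\<close>, the only case in which it is used.\<close>

primrec subst :: "nat \<Rightarrow> tm \<Rightarrow> fm \<Rightarrow> fm" where
  "subst x t (Pos a) = Pos (subst_atom x t a)"
| "subst x t (Neg a) = Neg (subst_atom x t a)"
| "subst x t (Conj \<phi> \<psi>) = Conj (subst x t \<phi>) (subst x t \<psi>)"
| "subst x t (Disj \<phi> \<psi>) = Disj (subst x t \<phi>) (subst x t \<psi>)"
| "subst x t (All y \<phi>) = All y (if y = x then \<phi> else subst x t \<phi>)"
| "subst x t (Ex y \<phi>) = Ex y (if y = x then \<phi> else subst x t \<phi>)"

primrec eval_tm :: "(nat \<Rightarrow> nat) \<Rightarrow> tm \<Rightarrow> nat" where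
  "eval_tm e (Var x) = e x"
| "eval_tm e Zero = 0"
| "eval_tm e (Succ t) = Suc (eval_tm e t)"
| "eval_tm e (Add s t) = eval_tm e s + eval_tm e t"
| "eval_tm e (Mult s t) = eval_tm e s * eval_tm e t"

primrec sat_atom :: "nat set \<Rightarrow> (nat \<Rightarrow> nat) \<Rightarrow> atom \<Rightarrow> bool" where
  "sat_atom U e (Eq s t) \<longleftrightarrow> eval_tm e s = eval_tm e t"
| "sat_atom U e (Leq s t) \<longleftrightarrow> eval_tm e s \<le> eval_tm e t"
| "sat_atom U e (X t) \<longleftrightarrow> eval_tm e t \<in> U"

primrec sat :: "nat set \<Rightarrow> (nat \<Rightarrow> nat) \<Rightarrow> fm \<Rightarrow> bool" where
  "sat U e (Pos a) \<longleftrightarrow> sat_atom U e a"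
| "sat U e (Neg a) \<longleftrightarrow> \<not> sat_atom U e a"
| "sat U e (Conj \<phi> \<psi>) \<longleftrightarrow> sat U e \<phi> \<and> sat U e \<psi>"
| "sat U e (Disj \<phi> \<psi>) \<longleftrightarrow> sat U e \<phi> \<or> sat U e \<psi>"
| "sat U e (All x \<phi>) \<longleftrightarrow> (\<forall>n. sat U (e(x := n)) \<phi>)"
| "sat U e (Ex x \<phi>) \<longleftrightarrow> (\<exists>n. sat U (e(x := n)) \<phi>)"

text \<open>The standard model does not interpret \<open>X\<close>; for formulas without \<open>X\<close>
  the interpretation \<open>U\<close> is irrelevant, and we then take it to be empty.\<close>

lemma sat_PA_fm: "PA_fm \<phi> \<Longrightarrow> sat U e \<phi> = sat U' e \<phi>"
proof (induction \<phi> arbitrary: e)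
  case (Pos a) then show ?case by (cases a) auto
next
  case (Neg a) then show ?case by (cases a) auto
qed auto

abbreviation val :: "tm \<Rightarrow> nat" where
  "val t \<equiv> eval_tm (\<lambda>_. 0) t"

definition true_PA :: "fm \<Rightarrow> bool" where
  "true_PA \<phi> \<longleftrightarrow> PA_fm \<phi> \<and> sat {} (\<lambda>_. 0) \<phi>"

definition defined_rel :: "nat \<Rightarrow> nat \<Rightarrow> fm \<Rightarrow> (nat \<times> nat) set" where
  "defined_rel x y \<theta> = {(m, n). sat {} ((\<lambda>_. 0)(x := m, y := n)) \<theta>}"

definition defines_well_order :: "nat \<Rightarrow> nat \<Rightarrow> fm \<Rightarrow> bool" where
  "defines_well_order x y \<theta> \<longleftrightarrow>
     x \<noteq> y \<and> PA_fm \<theta> \<and> free_vars \<theta> \<subseteq> {x, y} \<and>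
     strict_linear_order_on UNIV (defined_rel x y \<theta>) \<and> wf (defined_rel x y \<theta>)"

text \<open>The well order \<open>(E, \<prec>)\<close> is the type \<open>'e\<close> with \<open><\<close>. The unary map \<open>\<alpha> \<mapsto> \<alpha> + 1\<close> is \<open>succ\<close>,
  the element \<open>\<omega>\<close> is \<open>om\<close>, and the map \<open>\<alpha> \<mapsto> \<omega>(\<alpha>)\<close> is \<open>om_exp\<close>.\<close>

locale ordinal_structure =
  fixes succ :: "'e::wellorder \<Rightarrow> 'e"
    and zero :: 'e
    and om :: 'e
    and add :: "'e \<Rightarrow> 'e \<Rightarrow> 'e"
    and om_exp :: "'e \<Rightarrow> 'e"
  assumes less_succ: "\<alpha> < succ \<alpha>"
    and zero_less_om: "zero < om"
    and succ_less_om: "\<alpha> < om \<Longrightarrow> succ \<alpha> < om"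
    and add_zero: "add \<alpha> zero = \<alpha>"
    and add_strict_mono: "\<beta> < \<gamma> \<Longrightarrow> add \<alpha> \<beta> < add \<alpha> \<gamma>"
    and om_exp_strict_mono: "\<alpha> < \<beta> \<Longrightarrow> om_exp \<alpha> < om_exp \<beta>"
    and add_less_om_exp: "\<alpha> < om_exp \<gamma> \<Longrightarrow> \<beta> < om_exp \<gamma> \<Longrightarrow> add \<alpha> \<beta> < om_exp \<gamma>"
    and succ_least: "\<alpha> < \<beta> \<Longrightarrow> succ \<alpha> \<le> \<beta>"
    and zero_least: "zero \<le> \<alpha>"

text \<open>\<open>derives R \<alpha> d \<Gamma>\<close> is \<open>\<turnstile>\<^sup>\<alpha>\<^sub>d \<Gamma>\<close>, where \<open>R\<close> is the relation on the natural numbers defined by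
  \<open>x \<lhd> y\<close>. All premises have strictly smaller height, so the least fixed point is the
  unique solution of the recursive characterization \<open>derives.simps\<close>.\<close>

inductive derives :: "(nat \<times> nat) set \<Rightarrow> 'e::wellorder \<Rightarrow> nat \<Rightarrow> fm set \<Rightarrow> bool"
  for R :: "(nat \<times> nat) set" where
  ax_true:
    "\<phi> \<in> \<Gamma> \<Longrightarrow> \<phi> = Pos a \<or> \<phi> = Neg a \<Longrightarrow> true_PA \<phi> \<Longrightarrow> derives R \<alpha> d \<Gamma>"
| ax_X:
    "Pos (X s) \<in> \<Gamma> \<Longrightarrow> Neg (X t) \<in> \<Gamma> \<Longrightarrow> closed_tm s \<Longrightarrow> closed_tm t \<Longrightarrow> val s = val t
     \<Longrightarrow> derives R \<alpha> d \<Gamma>"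
| conj:
    "Conj \<phi>\<^sub>0 \<phi>\<^sub>1 \<in> \<Gamma>
     \<Longrightarrow> \<forall>\<phi>\<in>{\<phi>\<^sub>0, \<phi>\<^sub>1}. \<exists>\<beta> e \<Delta>. \<beta> < \<alpha> \<and> e \<le> d \<and> \<Delta> \<subseteq> insert \<phi> \<Gamma> \<and> derives R \<beta> e \<Delta>
     \<Longrightarrow> derives R \<alpha> d \<Gamma>"
| disj:
    "Disj \<phi>\<^sub>0 \<phi>\<^sub>1 \<in> \<Gamma>
     \<Longrightarrow> \<exists>\<phi>\<in>{\<phi>\<^sub>0, \<phi>\<^sub>1}. \<exists>\<beta> e \<Delta>. \<beta> < \<alpha> \<and> e \<le> d \<and> \<Delta> \<subseteq> insert \<phi> \<Gamma> \<and> derives R \<beta> e \<Delta>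
     \<Longrightarrow> derives R \<alpha> d \<Gamma>"
| all:
    "All x \<phi> \<in> \<Gamma>
     \<Longrightarrow> \<forall>t. closed_tm t \<longrightarrow>
           (\<exists>\<beta> e \<Delta>. \<beta> < \<alpha> \<and> e \<le> d \<and> \<Delta> \<subseteq> insert (subst x t \<phi>) \<Gamma> \<and> derives R \<beta> e \<Delta>)
     \<Longrightarrow> derives R \<alpha> d \<Gamma>"
| ex:
    "Ex x \<phi> \<in> \<Gamma>
     \<Longrightarrow> \<exists>t. closed_tm t \<and>
           (\<exists>\<beta> e \<Delta>. \<beta> < \<alpha> \<and> e \<le> d \<and> \<Delta> \<subseteq> insert (subst x t \<phi>) \<Gamma> \<and> derives R \<beta> e \<Delta>)
     \<Longrightarrow> derives R \<alpha> d \<Gamma>"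
| prog:
    "Pos (X t) \<in> \<Gamma> \<Longrightarrow> closed_tm t
     \<Longrightarrow> \<forall>s. closed_tm s \<and> (val s, val t) \<in> R \<longrightarrow>
           (\<exists>\<beta> e \<Delta>. \<beta> < \<alpha> \<and> e \<le> d \<and> \<Delta> \<subseteq> insert (Pos (X s)) \<Gamma> \<and> derives R \<beta> e \<Delta>)
     \<Longrightarrow> derives R \<alpha> d \<Gamma>"
| cut:
    "sentence \<phi> \<Longrightarrow> rk \<phi> < d
     \<Longrightarrow> \<forall>\<psi>\<in>{\<phi>, neg \<phi>}. \<exists>\<beta> e \<Delta>. \<beta> < \<alpha> \<and> e \<le> d \<and> \<Delta> \<subseteq> insert \<psi> \<Gamma> \<and> derives R \<beta> e \<Delta>
     \<Longrightarrow> derives R \<alpha> d \<Gamma>"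

end

theory Submission
  imports Defs
begin

text \<open>To lower the cut rank from \<open>d + 1\<close> to \<open>d\<close>, a cut over a formula \<open>\<chi>\<close> of rank \<open>d\<close> is pushed
  upwards through the derivation of the premise containing whichever of \<open>\<chi>\<close>, \<open>\<not> \<chi>\<close> is a disjunction,
  an existential formula or a negative literal \<open>\<not> Xt\<close>; where that formula is principal, inversion of
  the other premise allows a cut of smaller rank. Starting from heights \<open>\<alpha>\<close> and \<open>\<beta>\<close> this gives height
  \<open>\<alpha> + \<beta>\<close>, and \<open>\<omega>(\<gamma>)\<close> is closed under addition. The formula \<open>\<not> Xt\<close> is principal only in axioms,
  so the rule that introduces \<open>Xt\<close> from all \<open>Xs\<close> with \<open>s \<lhd> t\<close> never meets a dual rule. It suffices
  there that \<open>Xt\<close> may be replaced by \<open>Xs\<close> when \<open>s\<close> and \<open>t\<close> have the same value.\<close>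

section \<open>Rank, negation and substitution of closed terms\<close>

lemma rk_neg [simp]: "rk (neg \<phi>) = rk \<phi>"
  by (induction \<phi>) auto

lemma rk_subst [simp]: "rk (subst x t \<phi>) = rk \<phi>"
  by (induction \<phi>) auto

lemma neg_subst: "neg (subst x t \<phi>) = subst x t (neg \<phi>)"
  by (induction \<phi>) auto

lemma vars_subst_tm: "closed_tm t \<Longrightarrow> vars_tm (subst_tm x t s) = vars_tm s - {x}"
  by (induction s) (auto simp: closed_tm_def)

lemma vars_subst_atom: "closed_tm t \<Longrightarrow> vars_atom (subst_atom x t a) = vars_atom a - {x}"
  by (cases a) (auto simp: vars_subst_tm)

lemma free_vars_subst: "closed_tm t \<Longrightarrow> free_vars (subst x t \<phi>) = free_vars \<phi> - {x}"
  by (induction \<phi>) (auto simp: vars_subst_atom)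

lemma free_vars_neg [simp]: "free_vars (neg \<phi>) = free_vars \<phi>"
  by (induction \<phi>) auto

lemma sentence_neg [simp]: "sentence (neg \<phi>) \<longleftrightarrow> sentence \<phi>"
  by (simp add: sentence_def)

section \<open>Weakening and the cut rule\<close>

text \<open>Weakening is built into the premises of every rule: the bounds on height, cut rank and
  side formulas only get looser. It therefore suffices to repeat the last inference with the same
  premises, and a case distinction replaces an induction.\<close>

lemma derives_mono:
  assumes "derives R \<beta> e \<Delta>" and "\<beta> \<le> \<alpha>" and "e \<le> d" and "\<Delta> \<subseteq> \<Gamma>"
  shows "derives R \<alpha> d \<Gamma>"
proof -
  have prem: "\<exists>\<gamma> e' \<Delta>'. \<gamma> < \<alpha> \<and> e' \<le> d \<and> \<Delta>' \<subseteq> insert \<phi> \<Gamma> \<and> derives R \<gamma> e' \<Delta>'"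
    if "\<exists>\<gamma> e' \<Delta>'. \<gamma> < \<beta> \<and> e' \<le> e \<and> \<Delta>' \<subseteq> insert \<phi> \<Delta> \<and> derives R \<gamma> e' \<Delta>'" for \<phi>
  proof -
    from that obtain \<gamma> e' \<Delta>'
      where "\<gamma> < \<beta>" "e' \<le> e" "\<Delta>' \<subseteq> insert \<phi> \<Delta>" "derives R \<gamma> e' \<Delta>'"
      by blast
    moreover from this have "\<gamma> < \<alpha>" "e' \<le> d" "\<Delta>' \<subseteq> insert \<phi> \<Gamma>"
      using assms by auto
    ultimately show ?thesis by blast
  qed
  from assms(1) show ?thesis
  proof cases
    case (ax_true \<phi> a)
    then show ?thesis using assms(4) by (blast intro: derives.ax_true)
  next
    case (ax_X s t)
    then show ?thesis using assms(4) by (blast intro: derives.ax_X)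
  next
    case (conj \<phi>\<^sub>0 \<phi>\<^sub>1)
    then show ?thesis using assms(4) by (intro derives.conj[of \<phi>\<^sub>0 \<phi>\<^sub>1] ballI prem) auto
  next
    case (disj \<phi>\<^sub>0 \<phi>\<^sub>1)
    from disj(2) obtain \<phi> where "\<phi> \<in> {\<phi>\<^sub>0, \<phi>\<^sub>1}"
      and "\<exists>\<gamma> e' \<Delta>'. \<gamma> < \<beta> \<and> e' \<le> e \<and> \<Delta>' \<subseteq> insert \<phi> \<Delta> \<and> derives R \<gamma> e' \<Delta>'"
      by blast
    then show ?thesis using disj(1) assms(4)
      by (intro derives.disj[of \<phi>\<^sub>0 \<phi>\<^sub>1] bexI[of _ \<phi>] prem) auto
  next
    case (all x \<phi>)
    then show ?thesis using assms(4) by (intro derives.all[of x \<phi>] allI impI prem) auto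
  next
    case (ex x \<phi>)
    from ex(2) obtain t where "closed_tm t"
      and "\<exists>\<gamma> e' \<Delta>'. \<gamma> < \<beta> \<and> e' \<le> e \<and> \<Delta>' \<subseteq> insert (subst x t \<phi>) \<Delta> \<and> derives R \<gamma> e' \<Delta>'"
      by blast
    then show ?thesis using ex(1) assms(4)
      by (intro derives.ex[of x \<phi>] exI[of _ t] conjI prem) auto
  next
    case (prog t)
    then show ?thesis using assms(4) by (intro derives.prog[of t] allI impI prem) auto
  next
    case (cut \<phi>)
    then show ?thesis using assms(3) by (intro derives.cut[of \<phi>] ballI prem) auto
  qed
qed

lemma derives_cut:
  assumes "sentence \<phi>" and "rk \<phi> < d"
    and "derives R \<beta> d (insert \<phi> \<Gamma>)" and "\<beta> < \<alpha>"
    and "derives R \<gamma> d (insert (neg \<phi>) \<Gamma>)" and "\<gamma> < \<alpha>"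
  shows "derives R \<alpha> d \<Gamma>"
  using assms by (intro derives.cut[of \<phi>]) blast+

section \<open>Removing a formula from a derivation\<close>

text \<open>The inductions over derivations that remove a formula \<open>\<chi>\<close> from the end sequent differ only
  where \<open>\<chi>\<close> is principal. The predicate \<open>Q\<close> collects what is known about the remaining sequent.\<close>

lemma derives_remove:
  fixes f :: "'e::wellorder \<Rightarrow> 'e"
  assumes "derives R \<beta> e \<Delta>" and "e \<le> d" and "\<Delta> \<subseteq> insert \<chi> \<Gamma>" and "Q \<Gamma>"
    and f_mono: "\<And>\<beta> \<gamma>. \<gamma> < \<beta> \<Longrightarrow> f \<gamma> < f \<beta>"
    and Q_mono: "\<And>\<Gamma> \<phi>. Q \<Gamma> \<Longrightarrow> Q (insert \<phi> \<Gamma>)"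
    and lit: "\<And>a. \<chi> = Pos a \<or> \<chi> = Neg a \<Longrightarrow> \<not> true_PA \<chi>"
    and pos: "\<And>s t \<Gamma> \<beta>. \<lbrakk>\<chi> = Pos (X s); Neg (X t) \<in> \<Gamma>; closed_tm s; closed_tm t;
                val s = val t; Q \<Gamma>\<rbrakk> \<Longrightarrow> derives R (f \<beta>) d \<Gamma>"
    and neg: "\<And>s t \<Gamma> \<beta>. \<lbrakk>\<chi> = Neg (X t); Pos (X s) \<in> \<Gamma>; closed_tm s; closed_tm t;
                val s = val t; Q \<Gamma>\<rbrakk> \<Longrightarrow> derives R (f \<beta>) d \<Gamma>"
    and main_conj: "\<And>\<phi>\<^sub>0 \<phi>\<^sub>1 \<Gamma> \<beta>. \<lbrakk>\<chi> = Conj \<phi>\<^sub>0 \<phi>\<^sub>1; Q \<Gamma>;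
                \<forall>\<phi>\<in>{\<phi>\<^sub>0, \<phi>\<^sub>1}. \<exists>\<gamma><\<beta>. derives R (f \<gamma>) d (insert \<phi> \<Gamma>)\<rbrakk> \<Longrightarrow> derives R (f \<beta>) d \<Gamma>"
    and main_disj: "\<And>\<phi>\<^sub>0 \<phi>\<^sub>1 \<phi> \<Gamma> \<beta> \<gamma>. \<lbrakk>\<chi> = Disj \<phi>\<^sub>0 \<phi>\<^sub>1; Q \<Gamma>; \<phi> \<in> {\<phi>\<^sub>0, \<phi>\<^sub>1}; \<gamma> < \<beta>;
                derives R (f \<gamma>) d (insert \<phi> \<Gamma>)\<rbrakk> \<Longrightarrow> derives R (f \<beta>) d \<Gamma>"
    and main_all: "\<And>x \<phi> \<Gamma> \<beta>. \<lbrakk>\<chi> = All x \<phi>; Q \<Gamma>;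
                \<forall>t. closed_tm t \<longrightarrow> (\<exists>\<gamma><\<beta>. derives R (f \<gamma>) d (insert (subst x t \<phi>) \<Gamma>))\<rbrakk>
                \<Longrightarrow> derives R (f \<beta>) d \<Gamma>"
    and main_ex: "\<And>x \<phi> t \<Gamma> \<beta> \<gamma>. \<lbrakk>\<chi> = Ex x \<phi>; Q \<Gamma>; closed_tm t; \<gamma> < \<beta>;
                derives R (f \<gamma>) d (insert (subst x t \<phi>) \<Gamma>)\<rbrakk> \<Longrightarrow> derives R (f \<beta>) d \<Gamma>"
    and main_prog: "\<And>t \<Gamma> \<beta>. \<lbrakk>\<chi> = Pos (X t); Q \<Gamma>; closed_tm t;
                \<forall>s. closed_tm s \<and> (val s, val t) \<in> R \<longrightarrow>
                  (\<exists>\<gamma><\<beta>. derives R (f \<gamma>) d (insert (Pos (X s)) \<Gamma>))\<rbrakk> \<Longrightarrow> derives R (f \<beta>) d \<Gamma>"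
  shows "derives R (f \<beta>) d \<Gamma>"
proof -
  \<comment> \<open>\<open>\<Gamma>\<close> is quantified here because each premise adds its side
    formula \<open>\<phi>\<close> to it: a premise sequent lies in
    \<open>insert \<chi> (insert \<phi> \<Gamma>)\<close>. Accordingly \<open>Q\<close> has to
    survive insertions.\<close>
  define IH where "IH \<beta> e \<Delta> \<longleftrightarrow>
    (\<forall>\<Gamma>. e \<le> d \<longrightarrow> \<Delta> \<subseteq> insert \<chi> \<Gamma> \<longrightarrow> Q \<Gamma> \<longrightarrow> derives R (f \<beta>) d \<Gamma>)" for \<beta> e \<Delta>
  have prem: "\<exists>\<gamma><\<beta>. derives R (f \<gamma>) d (insert \<phi> \<Gamma>)"
    if "\<exists>\<gamma> e' \<Delta>'. \<gamma> < \<beta> \<and> e' \<le> e \<and> \<Delta>' \<subseteq> insert \<phi> \<Delta> \<and> derives R \<gamma> e' \<Delta>' \<and> IH \<gamma> e' \<Delta>'"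
      and "e \<le> d" and "\<Delta> \<subseteq> insert \<chi> \<Gamma>" and "Q \<Gamma>" for \<beta> e \<Delta> \<Gamma> \<phi>
  proof -
    from that(1) obtain \<gamma> e' \<Delta>'
      where "\<gamma> < \<beta>" "e' \<le> e" "\<Delta>' \<subseteq> insert \<phi> \<Delta>" "IH \<gamma> e' \<Delta>'"
      by blast
    moreover from this have "e' \<le> d" "\<Delta>' \<subseteq> insert \<chi> (insert \<phi> \<Gamma>)"
      using that by auto
    ultimately show ?thesis using Q_mono[OF that(4)] unfolding IH_def by blast
  qed
  have weaken: "\<exists>\<gamma>' e' \<Delta>'. \<gamma>' < f \<beta> \<and> e' \<le> d \<and> \<Delta>' \<subseteq> insert \<phi> \<Gamma> \<and> derives R \<gamma>' e' \<Delta>'"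
    if "\<exists>\<gamma><\<beta>. derives R (f \<gamma>) d (insert \<phi> \<Gamma>)" for \<beta> \<phi> \<Gamma>
    using that f_mono by blast
  have "IH \<beta> e \<Delta>"
    using assms(1)
  proof (induction rule: derives.induct)
    \<comment> \<open>By \<open>lit\<close>, \<open>\<chi>\<close> is not a true literal, so the
      literal that makes this an axiom remains in \<open>\<Gamma>\<close>.\<close>
    case (ax_true \<phi> \<Delta> a \<beta> e)
    then show ?case
      unfolding IH_def by (metis derives.ax_true insertE lit subsetD)
  next
    case (ax_X s \<Delta> t \<beta> e)
    show ?case
      unfolding IH_def
    proof (intro allI impI)
      fix \<Gamma> assume "\<Delta> \<subseteq> insert \<chi> \<Gamma>" and "Q \<Gamma>"
      \<comment> \<open>The two literals have opposite polarity, so \<open>\<chi>\<close> is at most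
        one of them.\<close>
      with ax_X consider "\<chi> = Pos (X s)" "Neg (X t) \<in> \<Gamma>" | "\<chi> = Neg (X t)" "Pos (X s) \<in> \<Gamma>"
        | "Pos (X s) \<in> \<Gamma>" "Neg (X t) \<in> \<Gamma>"
        by auto
      then show "derives R (f \<beta>) d \<Gamma>"
        using ax_X(3-5) \<open>Q \<Gamma>\<close> by cases (rule pos neg derives.ax_X; assumption)+
    qed
  next
    case (conj \<phi>\<^sub>0 \<phi>\<^sub>1 \<Delta> \<beta> e)
    show ?case
      unfolding IH_def
    proof (intro allI impI)
      fix \<Gamma> assume \<Gamma>: "e \<le> d" "\<Delta> \<subseteq> insert \<chi> \<Gamma>" "Q \<Gamma>"
      then have *: "\<forall>\<phi>\<in>{\<phi>\<^sub>0, \<phi>\<^sub>1}. \<exists>\<gamma><\<beta>. derives R (f \<gamma>) d (insert \<phi> \<Gamma>)"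
        using conj(2) by (blast intro: prem)
      \<comment> \<open>If \<open>\<chi>\<close> is principal, the matching hypothesis applies; the
        premises in \<open>*\<close> are already cleared of any further copy of
        \<open>\<chi>\<close> kept as a side formula. Otherwise the same rule is applied again, now
        with heights under \<open>f\<close>. The remaining logical rules and the rule for
        \<open>X\<close> follow this pattern.\<close>
      from \<Gamma>(2) conj(1) have "\<chi> = Conj \<phi>\<^sub>0 \<phi>\<^sub>1 \<or> Conj \<phi>\<^sub>0 \<phi>\<^sub>1 \<in> \<Gamma>" by auto
      then show "derives R (f \<beta>) d \<Gamma>"
      proof
        assume "\<chi> = Conj \<phi>\<^sub>0 \<phi>\<^sub>1"
        then show ?thesis using \<Gamma>(3) * by (rule main_conj)
      next
        assume "Conj \<phi>\<^sub>0 \<phi>\<^sub>1 \<in> \<Gamma>"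
        then show ?thesis using * by (intro derives.conj[of \<phi>\<^sub>0 \<phi>\<^sub>1] ballI weaken) auto
      qed
    qed
  next
    case (disj \<phi>\<^sub>0 \<phi>\<^sub>1 \<Delta> \<beta> e)
    show ?case
      unfolding IH_def
    proof (intro allI impI)
      fix \<Gamma> assume \<Gamma>: "e \<le> d" "\<Delta> \<subseteq> insert \<chi> \<Gamma>" "Q \<Gamma>"
      then have *: "\<exists>\<phi>\<in>{\<phi>\<^sub>0, \<phi>\<^sub>1}. \<exists>\<gamma><\<beta>. derives R (f \<gamma>) d (insert \<phi> \<Gamma>)"
        using disj(2) by (blast intro: prem)
      from \<Gamma>(2) disj(1) have "\<chi> = Disj \<phi>\<^sub>0 \<phi>\<^sub>1 \<or> Disj \<phi>\<^sub>0 \<phi>\<^sub>1 \<in> \<Gamma>" by auto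
      then show "derives R (f \<beta>) d \<Gamma>"
      proof
        assume "\<chi> = Disj \<phi>\<^sub>0 \<phi>\<^sub>1"
        then show ?thesis using \<Gamma>(3) * main_disj by blast
      next
        assume "Disj \<phi>\<^sub>0 \<phi>\<^sub>1 \<in> \<Gamma>"
        then show ?thesis using * weaken by (intro derives.disj[of \<phi>\<^sub>0 \<phi>\<^sub>1]) blast+
      qed
    qed
  next
    case (all x \<phi> \<Delta> \<beta> e)
    show ?case
      unfolding IH_def
    proof (intro allI impI)
      fix \<Gamma> assume \<Gamma>: "e \<le> d" "\<Delta> \<subseteq> insert \<chi> \<Gamma>" "Q \<Gamma>"
      then have *: "\<forall>t. closed_tm t \<longrightarrow> (\<exists>\<gamma><\<beta>. derives R (f \<gamma>) d (insert (subst x t \<phi>) \<Gamma>))"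
        using all(2) by (blast intro: prem)
      from \<Gamma>(2) all(1) have "\<chi> = All x \<phi> \<or> All x \<phi> \<in> \<Gamma>" by auto
      then show "derives R (f \<beta>) d \<Gamma>"
      proof
        assume "\<chi> = All x \<phi>"
        then show ?thesis using \<Gamma>(3) * by (rule main_all)
      next
        assume "All x \<phi> \<in> \<Gamma>"
        then show ?thesis using * by (intro derives.all[of x \<phi>] allI impI weaken) auto
      qed
    qed
  next
    case (ex x \<phi> \<Delta> \<beta> e)
    show ?case
      unfolding IH_def
    proof (intro allI impI)
      fix \<Gamma> assume \<Gamma>: "e \<le> d" "\<Delta> \<subseteq> insert \<chi> \<Gamma>" "Q \<Gamma>"
      then have *: "\<exists>t. closed_tm t \<and> (\<exists>\<gamma><\<beta>. derives R (f \<gamma>) d (insert (subst x t \<phi>) \<Gamma>))"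
        using ex(2) by (blast intro: prem)
      from \<Gamma>(2) ex(1) have "\<chi> = Ex x \<phi> \<or> Ex x \<phi> \<in> \<Gamma>" by auto
      then show "derives R (f \<beta>) d \<Gamma>"
      proof
        assume "\<chi> = Ex x \<phi>"
        then show ?thesis using \<Gamma>(3) * main_ex by blast
      next
        assume "Ex x \<phi> \<in> \<Gamma>"
        then show ?thesis using * weaken by (intro derives.ex[of x \<phi>]) blast+
      qed
    qed
  next
    case (prog t \<Delta> \<beta> e)
    show ?case
      unfolding IH_def
    proof (intro allI impI)
      fix \<Gamma> assume \<Gamma>: "e \<le> d" "\<Delta> \<subseteq> insert \<chi> \<Gamma>" "Q \<Gamma>"
      then have *: "\<forall>s. closed_tm s \<and> (val s, val t) \<in> R \<longrightarrow>
          (\<exists>\<gamma><\<beta>. derives R (f \<gamma>) d (insert (Pos (X s)) \<Gamma>))"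
        using prog(3) by (blast intro: prem)
      from \<Gamma>(2) prog(1) have "\<chi> = Pos (X t) \<or> Pos (X t) \<in> \<Gamma>" by auto
      then show "derives R (f \<beta>) d \<Gamma>"
      proof
        assume "\<chi> = Pos (X t)"
        then show ?thesis using \<Gamma>(3) prog(2) * by (rule main_prog)
      next
        assume "Pos (X t) \<in> \<Gamma>"
        then show ?thesis using prog(2) * by (intro derives.prog[of t] allI impI weaken) auto
      qed
    qed
  next
    case (cut \<phi> e \<beta> \<Delta>)
    show ?case
      unfolding IH_def
    proof (intro allI impI)
      fix \<Gamma> assume \<Gamma>: "e \<le> d" "\<Delta> \<subseteq> insert \<chi> \<Gamma>" "Q \<Gamma>"
      \<comment> \<open>A cut has no principal formula in its conclusion, so it is always repeated;
        its rank stays below \<open>d\<close> because \<open>e \<le> d\<close>.\<close>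
      then have "\<forall>\<psi>\<in>{\<phi>, neg \<phi>}. \<exists>\<gamma><\<beta>. derives R (f \<gamma>) d (insert \<psi> \<Gamma>)"
        using cut(3) by (blast intro: prem)
      then show "derives R (f \<beta>) d \<Gamma>"
        using cut(1,2) \<Gamma>(1) weaken by (intro derives.cut[of \<phi>]) auto
    qed
  qed
  then show ?thesis using assms(2-4) unfolding IH_def by blast
qed

section \<open>False literals, terms of equal value, and inversion\<close>

text \<open>A false literal without \<open>X\<close> is never principal, neither in an axiom nor in
  a rule, so every inference survives its deletion at the same height.\<close>

lemma derives_false_literal:
  assumes "derives R \<alpha> d (insert \<chi> \<Gamma>)" and "\<chi> = Pos a \<or> \<chi> = Neg a"
    and "PA_fm \<chi>" and "\<not> true_PA \<chi>"
  shows "derives R \<alpha> d \<Gamma>"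
  by (rule derives_remove[where f = "\<lambda>\<beta>. \<beta>" and Q = "\<lambda>_. True" and \<chi> = \<chi>, OF assms(1)])
    (use assms in auto)

text \<open>Axioms and the rule for \<open>X\<close> depend on a closed term only through its value.
  Wherever \<open>Xt\<close> is principal, \<open>Xs\<close> can take its place; the invariant keeps
  \<open>Xs\<close> in the sequent.\<close>

lemma derives_X_eq_val:
  assumes "derives R \<alpha> d (insert (Pos (X t)) \<Gamma>)" and "Pos (X s) \<in> \<Gamma>"
    and "closed_tm s" and "val s = val t"
  shows "derives R \<alpha> d \<Gamma>"
proof (rule derives_remove[where f = "\<lambda>\<beta>. \<beta>" and Q = "\<lambda>\<Gamma>. Pos (X s) \<in> \<Gamma>", OF assms(1)])
  fix t' u and \<Gamma> :: "fm set" and \<beta> :: 'a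
  assume "Pos (X t) = Pos (X t')" "Neg (X u) \<in> \<Gamma>" "closed_tm u" "val t' = val u"
    "Pos (X s) \<in> \<Gamma>"
  then show "derives R \<beta> d \<Gamma>"
    using assms by (intro derives.ax_X[of s \<Gamma> u]) auto
next
  fix t' and \<Gamma> :: "fm set" and \<beta> :: 'a
  assume "Pos (X t) = Pos (X t')" "Pos (X s) \<in> \<Gamma>"
    "\<forall>s. closed_tm s \<and> (val s, val t') \<in> R \<longrightarrow>
      (\<exists>\<gamma><\<beta>. derives R \<gamma> d (insert (Pos (X s)) \<Gamma>))"
  then show "derives R \<beta> d \<Gamma>"
    using assms by (intro derives.prog[of s]) (simp_all, blast)
qed (use assms in \<open>auto simp: true_PA_def\<close>)

text \<open>The invariant keeps \<open>\<phi>\<close> in the sequent. Where the conjunction is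
  principal, its premise for \<open>\<phi>\<close> is thus already a derivation of the wanted
  sequent, of smaller height.\<close>

lemma derives_Conj_inversion:
  assumes "derives R \<alpha> d (insert (Conj \<phi>\<^sub>0 \<phi>\<^sub>1) \<Gamma>)" and "\<phi> \<in> {\<phi>\<^sub>0, \<phi>\<^sub>1}"
  shows "derives R \<alpha> d (insert \<phi> \<Gamma>)"
proof (rule derives_remove[where f = "\<lambda>\<beta>. \<beta>" and Q = "\<lambda>\<Gamma>. \<phi> \<in> \<Gamma>", OF assms(1)])
  fix \<psi>\<^sub>0 \<psi>\<^sub>1 and \<Gamma> :: "fm set" and \<beta> :: 'a
  assume "Conj \<phi>\<^sub>0 \<phi>\<^sub>1 = Conj \<psi>\<^sub>0 \<psi>\<^sub>1" "\<phi> \<in> \<Gamma>"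
    "\<forall>\<phi>\<in>{\<psi>\<^sub>0, \<psi>\<^sub>1}. \<exists>\<gamma><\<beta>. derives R \<gamma> d (insert \<phi> \<Gamma>)"
  then obtain \<gamma> where "\<gamma> < \<beta>" "derives R \<gamma> d \<Gamma>"
    using assms(2) by (auto simp: insert_absorb)
  then show "derives R \<beta> d \<Gamma>"
    using derives_mono by (metis order_less_imp_le order_refl)
qed auto

text \<open>As for conjunctions, selecting the premise for the term \<open>t\<close> among the
  infinitely many premises.\<close>

lemma derives_All_inversion:
  assumes "derives R \<alpha> d (insert (All x \<phi>) \<Gamma>)" and "closed_tm t"
  shows "derives R \<alpha> d (insert (subst x t \<phi>) \<Gamma>)"
proof (rule derives_remove[where f = "\<lambda>\<beta>. \<beta>" and Q = "\<lambda>\<Gamma>. subst x t \<phi> \<in> \<Gamma>", OF assms(1)])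
  fix x' \<phi>' and \<Gamma> :: "fm set" and \<beta> :: 'a
  assume "All x \<phi> = All x' \<phi>'" "subst x t \<phi> \<in> \<Gamma>"
    "\<forall>t. closed_tm t \<longrightarrow> (\<exists>\<gamma><\<beta>. derives R \<gamma> d (insert (subst x' t \<phi>') \<Gamma>))"
  then obtain \<gamma> where "\<gamma> < \<beta>" "derives R \<gamma> d \<Gamma>"
    using assms(2) by (auto simp: insert_absorb)
  then show "derives R \<beta> d \<Gamma>"
    using derives_mono by (metis order_less_imp_le order_refl)
qed auto

section \<open>Reduction of a single cut\<close>

context ordinal_structure
begin

lemma le_add: "\<alpha> \<le> add \<alpha> \<beta>"
  by (metis add_strict_mono add_zero nless_le order_le_less zero_least)

lemma derives_reduction:
  \<comment> \<open>The induction runs over the derivation of \<open>\<chi>\<close>, so its height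
    must be the right summand, in which \<open>add\<close> is strictly monotone. The invariant
    carries the derivation of \<open>neg \<chi>\<close> along, weakened to the current
    sequent.\<close>
  assumes \<alpha>: "derives R \<alpha> d (insert (neg \<chi>) \<Gamma>)" and \<beta>: "derives R \<beta> d (insert \<chi> \<Gamma>)"
    and "sentence \<chi>" and "rk \<chi> \<le> d"
    and \<chi>: "(\<exists>t. \<chi> = Neg (X t)) \<or> (\<exists>\<phi>\<^sub>0 \<phi>\<^sub>1. \<chi> = Disj \<phi>\<^sub>0 \<phi>\<^sub>1) \<or> (\<exists>x \<phi>. \<chi> = Ex x \<phi>)"
  shows "derives R (add \<alpha> \<beta>) d \<Gamma>"
proof (rule derives_remove[where f = "add \<alpha>"
      and Q = "\<lambda>\<Gamma>. derives R \<alpha> d (insert (neg \<chi>) \<Gamma>)", OF \<beta>])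
  fix \<Gamma> :: "fm set" and \<phi> :: fm
  assume "derives R \<alpha> d (insert (neg \<chi>) \<Gamma>)"
  then show "derives R \<alpha> d (insert (neg \<chi>) (insert \<phi> \<Gamma>))"
    by (rule derives_mono) auto
next
  fix s t and \<Gamma> :: "fm set" and \<beta> :: 'e
  assume "\<chi> = Neg (X t)" "Pos (X s) \<in> \<Gamma>" "closed_tm s" "val s = val t"
    "derives R \<alpha> d (insert (neg \<chi>) \<Gamma>)"
  \<comment> \<open>Here \<open>neg \<chi>\<close> is \<open>Xt\<close>, and the axiom supplies
    \<open>Xs\<close> of equal value in the sequent, so \<open>Xt\<close> can be absorbed.\<close>
  then have "derives R \<alpha> d \<Gamma>"
    by (auto intro: derives_X_eq_val)
  then show "derives R (add \<alpha> \<beta>) d \<Gamma>"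
    by (rule derives_mono) (auto simp: le_add)
next
  fix \<phi>\<^sub>0 \<phi>\<^sub>1 \<phi> and \<Gamma> :: "fm set" and \<beta> \<gamma> :: 'e
  assume *: "\<chi> = Disj \<phi>\<^sub>0 \<phi>\<^sub>1" "derives R \<alpha> d (insert (neg \<chi>) \<Gamma>)" "\<phi> \<in> {\<phi>\<^sub>0, \<phi>\<^sub>1}" "\<gamma> < \<beta>"
    "derives R (add \<alpha> \<gamma>) d (insert \<phi> \<Gamma>)"
  have "derives R \<alpha> d (insert (neg \<phi>) \<Gamma>)"
    by (rule derives_Conj_inversion[of R \<alpha> d "neg \<phi>\<^sub>0" "neg \<phi>\<^sub>1"]) (use * in auto)
  \<comment> \<open>The rank drops strictly below \<open>d\<close>, so a cut on
    \<open>\<phi>\<close> is permitted. Both premise heights are small enough since \<alpha> \<le>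
    \<alpha> + \<gamma> < \<alpha> + \<beta>.\<close>
  moreover have "sentence \<phi>" "rk \<phi> < d"
    using * assms(3,4) by (auto simp: sentence_def)
  ultimately show "derives R (add \<alpha> \<beta>) d \<Gamma>"
    using * by (meson add_strict_mono derives_cut le_add order_le_less_trans)
next
  fix x \<phi> t and \<Gamma> :: "fm set" and \<beta> \<gamma> :: 'e
  assume *: "\<chi> = Ex x \<phi>" "derives R \<alpha> d (insert (neg \<chi>) \<Gamma>)" "closed_tm t" "\<gamma> < \<beta>"
    "derives R (add \<alpha> \<gamma>) d (insert (subst x t \<phi>) \<Gamma>)"
  have "derives R \<alpha> d (insert (neg (subst x t \<phi>)) \<Gamma>)"
    using * by (simp add: neg_subst derives_All_inversion)
  moreover have "sentence (subst x t \<phi>)" "rk (subst x t \<phi>) < d"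
    using * assms(3,4) by (auto simp: sentence_def free_vars_subst)
  ultimately show "derives R (add \<alpha> \<beta>) d \<Gamma>"
    using * by (meson add_strict_mono derives_cut le_add order_le_less_trans)
qed (use \<alpha> \<chi> in \<open>auto simp: true_PA_def add_strict_mono\<close>)

text \<open>Which of \<open>\<phi>\<close> and \<open>neg \<phi>\<close> has the shape required for
  reduction determines the order of the summands; \<open>om_exp \<gamma>\<close> bounds the sum in
  either order.\<close>

lemma derives_cut_admissible:
  assumes \<phi>: "derives R \<alpha> d (insert \<phi> \<Gamma>)" and neg: "derives R \<beta> d (insert (neg \<phi>) \<Gamma>)"
    and "sentence \<phi>" and "rk \<phi> \<le> d" and "\<alpha> < om_exp \<gamma>" and "\<beta> < om_exp \<gamma>"
  shows "derives R (om_exp \<gamma>) d \<Gamma>"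
proof -
  consider a where "\<phi> = Pos a \<or> \<phi> = Neg a" "PA_fm \<phi>"
    | "(\<exists>t. \<phi> = Neg (X t)) \<or> (\<exists>\<phi>\<^sub>0 \<phi>\<^sub>1. \<phi> = Disj \<phi>\<^sub>0 \<phi>\<^sub>1) \<or> (\<exists>x \<psi>. \<phi> = Ex x \<psi>)"
    | "(\<exists>t. neg \<phi> = Neg (X t)) \<or> (\<exists>\<phi>\<^sub>0 \<phi>\<^sub>1. neg \<phi> = Disj \<phi>\<^sub>0 \<phi>\<^sub>1) \<or> (\<exists>x \<psi>. neg \<phi> = Ex x \<psi>)"
  proof (cases \<phi>)
    case (Pos a) then show ?thesis using that by (cases a) auto
  next
    case (Neg a) then show ?thesis using that by (cases a) auto
  qed (use that in auto)
  then have "\<exists>\<delta><om_exp \<gamma>. derives R \<delta> d \<Gamma>"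
  proof cases
    case (1 a)
    show ?thesis
    \<comment> \<open>One of \<open>\<phi>\<close> and \<open>neg \<phi>\<close> is a false literal
      and can be deleted from its premise, which alone yields the result.\<close>
    proof (cases "true_PA \<phi>")
      case True
      then have "derives R \<beta> d \<Gamma>"
        using 1 by (intro derives_false_literal[OF neg, of a]) (auto simp: true_PA_def)
      then show ?thesis using assms by blast
    next
      case False
      then show ?thesis using derives_false_literal[OF \<phi>] 1 assms(5) by blast
    qed
  next
    case 2
    with neg \<phi> assms(3,4) have "derives R (add \<beta> \<alpha>) d \<Gamma>"
      by (rule derives_reduction)
    then show ?thesis using add_less_om_exp[OF assms(6,5)] by blast
  next
    case 3
    have "derives R (add \<alpha> \<beta>) d \<Gamma>"
      by (rule derives_reduction[OF _ neg]) (use \<phi> assms(3,4) 3 in \<open>simp_all add: neg_neg\<close>)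
    then show ?thesis using add_less_om_exp[OF assms(5,6)] by blast
  qed
  then show ?thesis
    using derives_mono by (metis order_less_imp_le order_refl)
qed

section \<open>Lowering the cut rank and iterating\<close>

text \<open>Premises may have smaller cut rank than the conclusion, hence the bound
  \<open>e \<le> d + 1\<close> in place of an equality. Strict monotonicity of \<open>om_exp\<close>
  preserves every rule other than cut.\<close>

lemma derives_lower_cut_rank:
  assumes "derives R \<alpha> e \<Gamma>" and "e \<le> d + 1"
  shows "derives R (om_exp \<alpha>) d \<Gamma>"
proof -
  define IH where "IH \<alpha> e \<Gamma> \<longleftrightarrow> (e \<le> d + 1 \<longrightarrow> derives R (om_exp \<alpha>) d \<Gamma>)" for \<alpha> e \<Gamma>
  have prem: "\<exists>\<beta>' e'' \<Delta>. \<beta>' < om_exp \<alpha> \<and> e'' \<le> d \<and> \<Delta> \<subseteq> insert \<phi> \<Gamma> \<and> derives R \<beta>' e'' \<Delta>"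
    if "\<exists>\<beta> e' \<Delta>. \<beta> < \<alpha> \<and> e' \<le> e \<and> \<Delta> \<subseteq> insert \<phi> \<Gamma> \<and> derives R \<beta> e' \<Delta> \<and> IH \<beta> e' \<Delta>"
      and "e \<le> d + 1" for \<alpha> e \<Gamma> \<phi>
    using that om_exp_strict_mono unfolding IH_def by (meson order_refl order_trans)
  have "IH \<alpha> e \<Gamma>"
    using assms(1)
  proof (induction rule: derives.induct)
    case (ax_true \<phi> \<Gamma> a \<alpha> e)
    then show ?case unfolding IH_def by (blast intro: derives.ax_true)
  next
    case (ax_X s \<Gamma> t \<alpha> e)
    then show ?case unfolding IH_def by (blast intro: derives.ax_X)
  next
    case (conj \<phi>\<^sub>0 \<phi>\<^sub>1 \<Gamma> \<alpha> e)
    show ?case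
      unfolding IH_def by (intro impI derives.conj[OF conj(1)] ballI prem) (use conj(2) in auto)
  next
    case (disj \<phi>\<^sub>0 \<phi>\<^sub>1 \<Gamma> \<alpha> e)
    from disj(2) show ?case
      unfolding IH_def using prem[unfolded IH_def] by (intro impI derives.disj[OF disj(1)]) blast
  next
    case (all x \<phi> \<Gamma> \<alpha> e)
    show ?case
      unfolding IH_def by (intro impI derives.all[OF all(1)] allI prem) (use all(2) in auto)
  next
    case (ex x \<phi> \<Gamma> \<alpha> e)
    from ex(2) show ?case
      unfolding IH_def using prem[unfolded IH_def] by (intro impI derives.ex[OF ex(1)]) blast
  next
    case (prog t \<Gamma> \<alpha> e)
    show ?case
      unfolding IH_def
      by (intro impI derives.prog[OF prog(1,2)] allI prem) (use prog(3) in auto)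
  next
    case (cut \<phi> e \<alpha> \<Gamma>)
    show ?case
      unfolding IH_def
    proof
      assume "e \<le> d + 1"
      have *: "\<exists>\<beta><om_exp \<alpha>. derives R \<beta> d (insert \<psi> \<Gamma>)" if "\<psi> \<in> {\<phi>, neg \<phi>}" for \<psi>
        using prem[OF cut(3)[rule_format, OF that] \<open>e \<le> d + 1\<close>] derives_mono by blast
      obtain \<beta> \<gamma> where "\<beta> < om_exp \<alpha>" "derives R \<beta> d (insert \<phi> \<Gamma>)"
        and "\<gamma> < om_exp \<alpha>" "derives R \<gamma> d (insert (neg \<phi>) \<Gamma>)"
        using * by blast
      \<comment> \<open>From \<open>rk \<phi> < e \<le> d + 1\<close>. Cuts of rank below
        \<open>d\<close> and of rank exactly \<open>d\<close> are treated alike.\<close>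
      moreover have "rk \<phi> \<le> d"
        using cut(2) \<open>e \<le> d + 1\<close> by simp
      ultimately show "derives R (om_exp \<alpha>) d \<Gamma>"
        using derives_cut_admissible cut(1) by blast
    qed
  qed
  then show ?thesis using assms(2) by (simp add: IH_def)
qed

text \<open>Lowering the rank once applies \<open>om_exp\<close> to the height first, so the
  induction hypothesis is used at \<open>om_exp \<alpha>\<close> and the height must be arbitrary;
  \<open>funpow_swap1\<close> moves this innermost application to the outside.\<close>

lemma derives_cut_elimination:
  "derives R \<alpha> d \<Gamma> \<Longrightarrow> derives R ((om_exp ^^ d) \<alpha>) 0 \<Gamma>"
proof (induction d arbitrary: \<alpha>)
  case (Suc d)
  then have "derives R ((om_exp ^^ d) (om_exp \<alpha>)) 0 \<Gamma>"
    by (simp add: derives_lower_cut_rank)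
  then show ?case by (simp add: funpow_swap1)
qed simp

end

theorem theorem4p7:
  fixes succ :: "'e::wellorder \<Rightarrow> 'e" and zero om :: 'e
    and add :: "'e \<Rightarrow> 'e \<Rightarrow> 'e" and om_exp :: "'e \<Rightarrow> 'e"
    and x y :: nat and lhd :: fm
    and \<alpha> :: 'e and d :: nat and \<Gamma> :: "fm set"
  assumes "ordinal_structure succ zero om add om_exp"
    and "defines_well_order x y lhd"
    and "sequent \<Gamma>"
  shows "(derives (defined_rel x y lhd) \<alpha> (d + 1) \<Gamma>
            \<longrightarrow> derives (defined_rel x y lhd) (om_exp \<alpha>) d \<Gamma>)
       \<and> (derives (defined_rel x y lhd) \<alpha> d \<Gamma>
            \<longrightarrow> derives (defined_rel x y lhd) ((om_exp ^^ d) \<alpha>) 0 \<Gamma>)"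
proof -
  interpret ordinal_structure succ zero om add om_exp
    by (rule assms(1))
  show ?thesis
    using derives_lower_cut_rank derives_cut_elimination by blast
qed

end
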